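(* Let $(a_j)_{j\ge1}$ be a sequence of positive integers such that $$a_{j+1}-a_j\ge2\quad\text{for all } j\ge1,\qquad\text{and}\qquad\sum_{j=1}^{+\infty}\frac{1}{a_{j+1}-a_j}=+\infty.$$ Then there exists $M\in\mathcal{LC}$ such that $(a_j)_{j\ge1}$ is a sequence of Lusky numbers for $M$.
   Context: $\mathbb{N}=\{0,1,2,\dots\}$. For a sequence $M=(M_p)_{p\in\mathbb{N}}$ of positive reals put $\mu_p:=M_p/M_{p-1}$ for $p\ge1$ and $\mu_0:=1$. $\mathcal{LC}$ is the set of all such $M$ with $M_0=1\le M_1$, $M_p^2\le M_{p-1}M_{p+1}$ for all $p\ge1$, and $\lim_{p\to\infty}(M_p)^{1/p}=+\infty$. For integers $0\le k<l$, $$A_M(k,l):=\frac{(\mu_{l+1})^{l-k}}{\mu_{k+1}\cdots\mu_l},\qquad B_M(k,l):=\frac{\mu_{k+1}\cdots\mu_l}{(\mu_{k+1})^{l-k}}.$$ A strictly increasing sequence of nonnegative integers $(a_j)_{j\ge1}$ is called a sequence of Lusky numbers for $M$ if there exist constants $K\ge b>2$ such that for all $j\ge1$: $b\le\min\{A_M(a_j,a_{j+1}),B_M(a_j,a_{j+1})\}\le\max\{A_M(a_j,a_{j+1}),B_M(a_j,a_{j+1})\}\le K$. *)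

theory Defs
  imports Complex_Main
begin

definition quot_seq :: "(nat \<Rightarrow> real) \<Rightarrow> nat \<Rightarrow> real" where
  "quot_seq M p = (if p = 0 then 1 else M p / M (p - 1))"

definition LC :: "(nat \<Rightarrow> real) set" where
  "LC = {M. (\<forall>p. M p > 0) \<and> M 0 = 1 \<and> 1 \<le> M 1 \<and>
            (\<forall>p\<ge>1. (M p)\<^sup>2 \<le> M (p - 1) * M (p + 1)) \<and>
            filterlim (\<lambda>p. M p powr (1 / real p)) at_top sequentially}"

text \<open>The two ratios below are only meaningful for \<^prop>\<open>k < l\<close>,
  so the truncated subtraction in the exponent is an honest difference.\<close>

definition Lusky_A :: "(nat \<Rightarrow> real) \<Rightarrow> nat \<Rightarrow> nat \<Rightarrow> real" where
  "Lusky_A M k l = quot_seq M (l + 1) ^ (l - k) / (\<Prod>i=k+1..l. quot_seq M i)"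

definition Lusky_B :: "(nat \<Rightarrow> real) \<Rightarrow> nat \<Rightarrow> nat \<Rightarrow> real" where
  "Lusky_B M k l = (\<Prod>i=k+1..l. quot_seq M i) / quot_seq M (k + 1) ^ (l - k)"

text \<open>Sequences \<open>(a\<^sub>j)\<close> with \<open>j \<ge> 1\<close> are functions on \<^typ>\<open>nat\<close> whose value at \<open>0\<close> is irrelevant.\<close>

definition Lusky_numbers :: "(nat \<Rightarrow> real) \<Rightarrow> (nat \<Rightarrow> nat) \<Rightarrow> bool" where
  "Lusky_numbers M a \<longleftrightarrow>
     strict_mono_on {1..} a \<and>
     (\<exists>b K. 2 < b \<and> b \<le> K \<and>
        (\<forall>j\<ge>1. b \<le> min (Lusky_A M (a j) (a (j + 1))) (Lusky_B M (a j) (a (j + 1))) \<and>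
               max (Lusky_A M (a j) (a (j + 1))) (Lusky_B M (a j) (a (j + 1))) \<le> K))"

end

theory Submission
  imports Defs
begin

text \<open>
  Write \<open>\<lambda>\<^sub>p = ln \<mu>\<^sub>p\<close>. Membership in \<^const>\<open>LC\<close> amounts to \<open>\<lambda>\<close> being nonnegative, nondecreasing
  and unbounded, while the logarithms of the two Lusky ratios on a block \<open>k < i \<le> l\<close> are the sums of
  \<open>\<lambda>\<^bsub>l+1\<^esub> - \<lambda>\<^sub>i\<close> and of \<open>\<lambda>\<^sub>i - \<lambda>\<^bsub>k+1\<^esub>\<close>. They add up to \<open>(l - k) (\<lambda>\<^bsub>l+1\<^esub> - \<lambda>\<^bsub>k+1\<^esub>)\<close>.
  With \<open>d\<^sub>j = a\<^bsub>j+1\<^esub> - a\<^sub>j\<close>, two-sided bounds on the ratios thus force \<open>\<lambda>\<close> to grow from the start of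
  one block to the start of the next by an amount comparable to \<open>1 / d\<^sub>j\<close>. Divergence of the sum of
  the \<open>1 / d\<^sub>j\<close> is what makes such a \<open>\<lambda>\<close> unbounded.

  It remains to place this growth so that neither ratio gets too small. Let \<open>\<lambda>\<close> be a step function
  which, for every \<open>j\<close>, jumps by \<open>4 / d\<^sub>j\<close> right after the first index of the block \<open>a\<^sub>j < i \<le> a\<^bsub>j+1\<^esub>\<close>
  and by \<open>4 / d\<^sub>j\<close> again right after its last index. Then the logarithms of the ratios are
  \<open>4 (d\<^sub>j + 1) / d\<^sub>j\<close> and \<open>4 (d\<^sub>j - 1) / d\<^sub>j\<close>, and since \<open>d\<^sub>j \<ge> 2\<close> both lie between \<open>2\<close> and \<open>6\<close>.
  So \<open>b = exp 2\<close>, which exceeds \<open>2\<close>, and \<open>K = exp 6\<close> are suitable.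
\<close>

section \<open>Weight sequences with prescribed logarithmic quotients\<close>

definition weight_of_log_quots :: "(nat \<Rightarrow> real) \<Rightarrow> nat \<Rightarrow> real" where
  "weight_of_log_quots f p = exp (\<Sum>i=1..p. f i)"

lemma quot_seq_weight_of_log_quots:
  assumes "p \<ge> 1"
  shows "quot_seq (weight_of_log_quots f) p = exp (f p)"
proof -
  obtain q where "p = Suc q" using assms by (cases p) auto
  then show ?thesis
    by (simp add: quot_seq_def weight_of_log_quots_def flip: exp_diff)
qed

lemma Lusky_A_weight_of_log_quots:
  assumes "k < l"
  shows "Lusky_A (weight_of_log_quots f) k l = exp (\<Sum>i=k+1..l. f (l + 1) - f i)"
proof -
  have "(\<Prod>i=k+1..l. quot_seq (weight_of_log_quots f) i) = exp (\<Sum>i=k+1..l. f i)"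
    by (simp add: exp_sum quot_seq_weight_of_log_quots)
  with assms show ?thesis
    by (simp add: Lusky_A_def quot_seq_weight_of_log_quots sum_subtractf exp_diff
        flip: exp_of_nat_mult)
qed

lemma Lusky_B_weight_of_log_quots:
  assumes "k < l"
  shows "Lusky_B (weight_of_log_quots f) k l = exp (\<Sum>i=k+1..l. f i - f (k + 1))"
proof -
  have "(\<Prod>i=k+1..l. quot_seq (weight_of_log_quots f) i) = exp (\<Sum>i=k+1..l. f i)"
    by (simp add: exp_sum quot_seq_weight_of_log_quots)
  with assms show ?thesis
    by (simp add: Lusky_B_def quot_seq_weight_of_log_quots sum_subtractf exp_diff
        flip: exp_of_nat_mult)
qed

text \<open>From some \<open>N\<close> on the terms exceed twice a given bound, and as soon as \<open>p \<ge> 2 N\<close> these are at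
  least half of the terms; the others are nonnegative.\<close>

lemma average_at_top:
  fixes f :: "nat \<Rightarrow> real"
  assumes nonneg: "\<And>i. f i \<ge> 0" and lim: "filterlim f at_top sequentially"
  shows "filterlim (\<lambda>p. (\<Sum>i=1..p. f i) / real p) at_top sequentially"
  unfolding filterlim_at_top_gt[where c = 0]
proof (intro allI impI)
  fix C :: real
  assume "0 < C"
  obtain N where N: "\<And>i. i \<ge> N \<Longrightarrow> f i \<ge> 2 * C"
    using lim unfolding filterlim_at_top eventually_sequentially by blast
  have "C \<le> (\<Sum>i=1..p. f i) / real p" if p: "p \<ge> 2 * N + 1" for p
  proof -
    have "real p * C \<le> real (p - N) * (2 * C)"
      using p \<open>0 < C\<close> by (simp add: of_nat_diff algebra_simps flip: mult_2_right)
    also have "\<dots> = (\<Sum>i=N+1..p. 2 * C)"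
      by simp
    also have "\<dots> \<le> (\<Sum>i=N+1..p. f i)"
      by (intro sum_mono N) auto
    also have "\<dots> \<le> (\<Sum>i=1..p. f i)"
      by (intro sum_mono2) (auto simp: nonneg)
    finally show ?thesis
      using p by (simp add: field_simps)
  qed
  then show "\<forall>\<^sub>F p in sequentially. C \<le> (\<Sum>i=1..p. f i) / real p"
    unfolding eventually_sequentially by blast
qed

lemma weight_of_log_quots_in_LC:
  assumes nonneg: "\<And>i. f i \<ge> 0" and "mono f" and lim: "filterlim f at_top sequentially"
  shows "weight_of_log_quots f \<in> LC"
proof -
  let ?M = "weight_of_log_quots f"
  have log_convex: "(?M p)\<^sup>2 \<le> ?M (p - 1) * ?M (p + 1)" if "p \<ge> 1" for p
  proof -
    obtain q where q: "p = Suc q" using \<open>p \<ge> 1\<close> by (cases p) auto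
    have "f (Suc q) \<le> f (Suc (Suc q))"
      using \<open>mono f\<close> by (simp add: monoD)
    then show ?thesis
      by (simp add: q weight_of_log_quots_def power2_eq_square flip: exp_add)
  qed
  have "filterlim (\<lambda>p. exp ((\<Sum>i=1..p. f i) / real p)) at_top sequentially"
    by (rule filterlim_compose[OF exp_at_top average_at_top[OF nonneg lim]])
  then have "filterlim (\<lambda>p. ?M p powr (1 / real p)) at_top sequentially"
    by (simp add: weight_of_log_quots_def powr_def)
  with log_convex show ?thesis
    by (simp add: LC_def) (simp add: weight_of_log_quots_def nonneg)
qed

section \<open>A logarithm with two jumps per block\<close>

text \<open>The value at \<open>i\<close> adds up the jumps that occur at or before \<open>i\<close>. They are found among the
  \<open>j < i\<close>: gaps of at least \<open>2\<close> give \<open>j \<le> a j + 1\<close>, while a jump of block \<open>j\<close> at or before \<open>i\<close>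
  requires \<open>a j + 1 < i\<close>.\<close>

definition two_step_log :: "(nat \<Rightarrow> nat) \<Rightarrow> nat \<Rightarrow> real" where
  "two_step_log a i = (\<Sum>j=1..<i. 4 / (real (a (j + 1)) - real (a j)) *
     (of_bool (a j + 1 < i) + of_bool (a (j + 1) < i)))"

context
  fixes a :: "nat \<Rightarrow> nat"
  assumes gap: "\<And>j. j \<ge> 1 \<Longrightarrow> a j + 2 \<le> a (j + 1)"
begin

lemma a_less: "1 \<le> r \<Longrightarrow> r < s \<Longrightarrow> a r < a s"
proof (induction s)
  case (Suc s)
  then show ?case using gap[of s] by (cases "r = s") auto
qed simp

lemma index_le: "1 \<le> j \<Longrightarrow> j \<le> a j + 1"
proof (induction j)
  case (Suc j)
  then show ?case using gap[of j] by (cases j) auto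
qed simp

lemma jump_nonneg: "1 \<le> j \<Longrightarrow> 4 / (real (a (j + 1)) - real (a j)) \<ge> 0"
  using gap[of j] by simp

lemma two_step_log_nonneg: "two_step_log a i \<ge> 0"
  unfolding two_step_log_def by (intro sum_nonneg mult_nonneg_nonneg jump_nonneg) auto

lemma mono_two_step_log: "mono (two_step_log a)"
proof (rule monoI)
  fix i i' :: nat
  assume "i \<le> i'"
  have "two_step_log a i \<le> (\<Sum>j=1..<i. 4 / (real (a (j + 1)) - real (a j)) *
     (of_bool (a j + 1 < i') + of_bool (a (j + 1) < i')))"
    unfolding two_step_log_def using \<open>i \<le> i'\<close>
    by (intro sum_mono mult_left_mono jump_nonneg add_mono) (auto simp: of_bool_def)
  also have "\<dots> \<le> two_step_log a i'"
    unfolding two_step_log_def using \<open>i \<le> i'\<close>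
    by (intro sum_mono2 mult_nonneg_nonneg jump_nonneg) auto
  finally show "two_step_log a i \<le> two_step_log a i'" .
qed

text \<open>For \<open>i\<close> inside block \<open>m\<close>, both jumps of every earlier block lie behind \<open>i\<close>, both jumps of every
  later block and the second jump of block \<open>m\<close> itself lie ahead of \<open>i\<close>, and only the first jump of
  block \<open>m\<close> depends on the position of \<open>i\<close>.\<close>

lemma two_step_log_block:
  assumes m: "m \<ge> 1" and i: "a m < i" "i \<le> a (m + 1)"
  shows "two_step_log a i = (\<Sum>j=1..<m. 8 / (real (a (j + 1)) - real (a j)))
           + 4 / (real (a (m + 1)) - real (a m)) * of_bool (a m + 1 < i)"
proof -
  let ?g = "\<lambda>j. 4 / (real (a (j + 1)) - real (a j)) *
     (of_bool (a j + 1 < i) + of_bool (a (j + 1) < i))"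
  have early: "a j + 1 < i \<and> a (j + 1) < i" if "j \<in> {1..<m}" for j
  proof -
    have "a (j + 1) \<le> a m"
      using that a_less[of "j + 1" m] by (cases "j + 1 = m") auto
    with that i gap[of j] show ?thesis by auto
  qed
  have late: "\<not> a j + 1 < i \<and> \<not> a (j + 1) < i" if "j > m" for j
  proof -
    have "a (m + 1) \<le> a j" "a j < a (j + 1)"
      using m that a_less[of "m + 1" j] a_less[of j "j + 1"] by (cases "j = m + 1"; force)+
    with i show ?thesis by auto
  qed
  \<comment> \<open>A summation range that contains both the defining one and \<open>{1..m}\<close>; which of
    these two is larger depends on \<open>a\<close>.\<close>
  have "two_step_log a i = (\<Sum>j=1..<m + i + 1. ?g j)"
    unfolding two_step_log_def
  proof (rule sum.mono_neutral_left)
    show "\<forall>j\<in>{1..<m + i + 1} - {1..<i}. ?g j = 0"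
    proof
      fix j assume "j \<in> {1..<m + i + 1} - {1..<i}"
      then have "j \<ge> 1" "j \<ge> i" by auto
      then have "\<not> a j + 1 < i \<and> \<not> a (j + 1) < i"
        using index_le[of j] index_le[of "j + 1"] gap[of j] by linarith
      then show "?g j = 0" by simp
    qed
  qed auto
  also have "\<dots> = (\<Sum>j\<in>{1..<m} \<union> {m}. ?g j)"
  proof (rule sum.mono_neutral_right)
    show "\<forall>j\<in>{1..<m + i + 1} - ({1..<m} \<union> {m}). ?g j = 0"
    proof
      fix j assume "j \<in> {1..<m + i + 1} - ({1..<m} \<union> {m})"
      then have "j > m" by auto
      from late[OF this] show "?g j = 0" by simp
    qed
  qed (use m in auto)
  also have "\<dots> = (\<Sum>j=1..<m. ?g j) + ?g m"
    by (subst sum.union_disjoint) auto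
  also have "(\<Sum>j=1..<m. ?g j) = (\<Sum>j=1..<m. 8 / (real (a (j + 1)) - real (a j)))"
    by (intro sum.cong refl) (use early in simp)
  finally show ?thesis using i by simp
qed

lemma two_step_log_block_start:
  assumes "m \<ge> 1"
  shows "two_step_log a (a m + 1) = (\<Sum>j=1..<m. 8 / (real (a (j + 1)) - real (a j)))"
  using two_step_log_block[OF assms, of "a m + 1"] gap[OF assms] by simp

lemma two_step_log_next_block_start:
  assumes "m \<ge> 1"
  shows "two_step_log a (a (m + 1) + 1)
           = two_step_log a (a m + 1) + 8 / (real (a (m + 1)) - real (a m))"
  using assms two_step_log_block_start[of m] two_step_log_block_start[of "m + 1"] by simp

lemma two_step_log_block_rest:
  assumes "m \<ge> 1" "i \<in> {a m + 2..a (m + 1)}"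
  shows "two_step_log a i = two_step_log a (a m + 1) + 4 / (real (a (m + 1)) - real (a m))"
  using assms two_step_log_block[of m i] two_step_log_block_start[of m] by simp

lemma two_step_log_at_top:
  assumes div: "filterlim (\<lambda>n. \<Sum>j=1..n. 1 / (real (a (j + 1)) - real (a j))) at_top sequentially"
  shows "filterlim (two_step_log a) at_top sequentially"
  unfolding filterlim_at_top
proof
  fix C :: real
  obtain n where n: "(\<Sum>j=1..n. 1 / (real (a (j + 1)) - real (a j))) \<ge> C / 8"
    using div unfolding filterlim_at_top eventually_sequentially by blast
  have "C \<le> 8 * (\<Sum>j=1..n. 1 / (real (a (j + 1)) - real (a j)))"
    using n by simp
  also have "\<dots> = two_step_log a (a (n + 1) + 1)"
    using two_step_log_block_start[of "n + 1"]
    by (simp add: sum_distrib_left atLeastLessThanSuc_atLeastAtMost)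
  finally have "C \<le> two_step_log a i" if "i \<ge> a (n + 1) + 1" for i
    using monoD[OF mono_two_step_log that] by linarith
  then show "\<forall>\<^sub>F i in sequentially. C \<le> two_step_log a i"
    unfolding eventually_sequentially by blast
qed

section \<open>The Lusky ratios on a block\<close>

lemma sum_block_split:
  fixes g :: "nat \<Rightarrow> real"
  assumes "m \<ge> 1" "\<And>i. i \<in> {a m + 2..a (m + 1)} \<Longrightarrow> g i = c"
  shows "(\<Sum>i=a m+1..a (m + 1). g i) = g (a m + 1) + (real (a (m + 1)) - real (a m) - 1) * c"
proof -
  have "(\<Sum>i=a m+1..a (m + 1). g i) = g (a m + 1) + (\<Sum>i=a m+2..a (m + 1). g i)"
    using gap[OF assms(1)] by (subst sum.atLeast_Suc_atMost) auto
  also have "(\<Sum>i=a m+2..a (m + 1). g i) = (\<Sum>i=a m+2..a (m + 1). c)"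
    by (intro sum.cong assms refl)
  finally show ?thesis using gap[OF assms(1)] by (simp add: of_nat_diff)
qed

lemma Lusky_A_two_step:
  assumes "m \<ge> 1"
  defines "d \<equiv> real (a (m + 1)) - real (a m)"
  shows "Lusky_A (weight_of_log_quots (two_step_log a)) (a m) (a (m + 1)) = exp (4 * (d + 1) / d)"
proof -
  have "d > 0" "a m < a (m + 1)" using gap[OF assms(1)] by (auto simp: d_def)
  have start: "two_step_log a (a (m + 1) + 1) = two_step_log a (a m + 1) + 8 / d"
    unfolding d_def by (rule two_step_log_next_block_start[OF assms(1)])
  have rest: "two_step_log a (a (m + 1) + 1) - two_step_log a i = 4 / d"
    if "i \<in> {a m + 2..a (m + 1)}" for i
    using two_step_log_block_rest[OF assms(1) that] start unfolding d_def[symmetric] by simp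
  have "(\<Sum>i=a m+1..a (m + 1). two_step_log a (a (m + 1) + 1) - two_step_log a i)
          = 8 / d + (d - 1) * (4 / d)"
    by (simp only: sum_block_split[OF assms(1) rest] d_def[symmetric]) (use start in simp)
  also have "\<dots> = 4 * (d + 1) / d"
    using \<open>d > 0\<close> by (simp add: field_simps)
  finally show ?thesis
    using \<open>a m < a (m + 1)\<close> by (simp only: Lusky_A_weight_of_log_quots)
qed

lemma Lusky_B_two_step:
  assumes "m \<ge> 1"
  defines "d \<equiv> real (a (m + 1)) - real (a m)"
  shows "Lusky_B (weight_of_log_quots (two_step_log a)) (a m) (a (m + 1)) = exp (4 * (d - 1) / d)"
proof -
  have "d > 0" "a m < a (m + 1)" using gap[OF assms(1)] by (auto simp: d_def)
  have "(\<Sum>i=a m+1..a (m + 1). two_step_log a i - two_step_log a (a m + 1)) = (d - 1) * (4 / d)"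
    unfolding d_def
    by (subst sum_block_split[OF assms(1), where c = "4 / (real (a (m + 1)) - real (a m))"])
      (use two_step_log_block_rest[OF assms(1)] in auto)
  then show ?thesis
    using \<open>a m < a (m + 1)\<close> by (simp only: Lusky_B_weight_of_log_quots) (simp add: mult.commute)
qed

lemma Lusky_numbers_two_step: "Lusky_numbers (weight_of_log_quots (two_step_log a)) a"
  unfolding Lusky_numbers_def
proof (intro conjI exI allI impI)
  show "strict_mono_on {1..} a"
    by (auto intro!: strict_mono_onI a_less)
  show "2 < exp (2::real)"
    using exp_ge_add_one_self[of "2::real"] by linarith
  show "exp (2::real) \<le> exp 6"
    by simp
  fix m :: nat
  assume m: "1 \<le> m"
  define d where "d = real (a (m + 1)) - real (a m)"
  have "d \<ge> 2" using gap[OF m] by (simp add: d_def)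
  then show "exp 2 \<le> min (Lusky_A (weight_of_log_quots (two_step_log a)) (a m) (a (m + 1)))
                 (Lusky_B (weight_of_log_quots (two_step_log a)) (a m) (a (m + 1)))"
    and "max (Lusky_A (weight_of_log_quots (two_step_log a)) (a m) (a (m + 1)))
             (Lusky_B (weight_of_log_quots (two_step_log a)) (a m) (a (m + 1))) \<le> exp 6"
    unfolding Lusky_A_two_step[OF m] Lusky_B_two_step[OF m] d_def[symmetric]
    by (auto simp: field_simps)
qed

end

theorem proposition5p3:
  fixes a :: "nat \<Rightarrow> nat"
  assumes "\<And>j. j \<ge> 1 \<Longrightarrow> a j > 0"
    and "\<And>j. j \<ge> 1 \<Longrightarrow> int (a (j + 1)) - int (a j) \<ge> 2"
    and "filterlim (\<lambda>n. \<Sum>j=1..n. 1 / (real (a (j + 1)) - real (a j))) at_top sequentially"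
  shows "\<exists>M\<in>LC. Lusky_numbers M a"
proof
  have gap: "a j + 2 \<le> a (j + 1)" if "j \<ge> 1" for j
    using assms(2)[OF that] by linarith
  show "weight_of_log_quots (two_step_log a) \<in> LC"
    using gap assms(3)
    by (intro weight_of_log_quots_in_LC two_step_log_nonneg mono_two_step_log two_step_log_at_top)
  show "Lusky_numbers (weight_of_log_quots (two_step_log a)) a"
    using gap by (rule Lusky_numbers_two_step)
qed

end
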